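(* Let $\mu$ be an invariant measure of a shift-invariant subset $S\subset C(\mathbb{R},X)$. Then, for every Borel subset $B\subset X$, we have $$\mu(B\cap B_\infty)=\mu(B),\qquad\text{where}\quad B_\infty:=\bigcap_{N=0}^\infty\bigcup_{n=N}^\infty V(n)^{-1}B.$$ In particular, $\mu$-almost every point in $B$ returns to $B$ infinitely often.
   Context: $X$ is a separable metric space, and $C(\mathbb{R},X)$ is the space of continuous maps $\mathbb{R}\to X$ with the compact-open topology (uniform convergence on compact sets). The shift is $\sigma(t,\phi)(s)=\phi(s+t)$; a subset $S\subset C(\mathbb{R},X)$ is shift-invariant if $\sigma(t,\phi)\in S$ for all $\phi\in S$ and $t\in\mathbb{R}$. Let $\pi(\phi)=\phi(0)$ be the evaluation-at-zero map. For a shift-invariant subset $S\subset C(\mathbb{R},X)$, a Borel probability measure $\mu$ on $X$ is invariant (an invariant measure of $S$) if there exists a Borel probability measure $\nu$ on $S$ that is invariant for the shift on $S$ and satisfies $\mu=\pi_*\nu$. For $t\in\mathbb{R}$ and $E\subset X$, $V(t)E:=\{\phi(t) : \phi\in S,\ \phi(0)\in E\}$ and $V(t)^{-1}E:=\{x\in X : V(t)\{x\}\cap E\neq\emptyset\}$, i.e. the set of $x\in X$ for which there is $\phi\in S$ with $\phi(0)=x$ and $\phi(t)\in E$.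
   Formalization: As B ∩ B_∞ may be non-measurable for general S, the equality is proved for outer measure, and Borel sets of points of B that do not return infinitely often are null; the literal equality and the almost-every claim are stated when B ∩ B_∞ is measurable for the completion of μ. *)

theory Defs
  imports "HOL-Probability.Probability"
begin

definition compact_open :: "(real \<Rightarrow> 'a::topological_space) topology" where
  "compact_open = topology_generated_by
     {{\<phi>. continuous_on UNIV \<phi> \<and> \<phi> ` K \<subseteq> U} | K U. compact K \<and> open U}"

text \<open>The underlying set is \<open>C(\<real>, X)\<close>, not the full function space.\<close>

lemma topspace_compact_open:
  "topspace compact_open = {\<phi> :: real \<Rightarrow> 'a::topological_space. continuous_on UNIV \<phi>}"
proof -
  have "{\<phi> :: real \<Rightarrow> 'a. continuous_on UNIV \<phi>} = {\<phi>. continuous_on UNIV \<phi> \<and> \<phi> ` {} \<subseteq> UNIV}"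
    by simp
  then have "{\<phi> :: real \<Rightarrow> 'a. continuous_on UNIV \<phi>} \<in>
      {{\<phi>. continuous_on UNIV \<phi> \<and> \<phi> ` K \<subseteq> U} | K U. compact K \<and> open U}"
    using compact_empty open_UNIV by blast
  then show ?thesis
    unfolding compact_open_def topology_generated_by_topspace by blast
qed

definition path_shift :: "real \<Rightarrow> (real \<Rightarrow> 'a) \<Rightarrow> (real \<Rightarrow> 'a)" where
  "path_shift t \<phi> = (\<lambda>s. \<phi> (s + t))"

definition shift_invariant :: "(real \<Rightarrow> 'a) set \<Rightarrow> bool" where
  "shift_invariant S \<longleftrightarrow> (\<forall>\<phi>\<in>S. \<forall>t. path_shift t \<phi> \<in> S)"

definition eval0 :: "(real \<Rightarrow> 'a) \<Rightarrow> 'a" where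
  "eval0 \<phi> = \<phi> 0"

definition borel_of :: "'b topology \<Rightarrow> 'b measure" where
  "borel_of T = sigma (topspace T) {U. openin T U}"

lemma space_borel_of [simp]: "space (borel_of T) = topspace T"
  by (simp add: borel_of_def space_measure_of_conv)

lemma sets_borel_of: "sets (borel_of T) = sigma_sets (topspace T) {U. openin T U}"
  unfolding borel_of_def by (rule sets_measure_of) (auto dest: openin_subset)

text \<open>\<open>S\<close> carries the subspace topology of \<open>C(\<real>, X)\<close>; it need not be a Borel subset of it.
  The maps \<open>path_shift t\<close> and \<open>eval0\<close> are measurable for the \<open>\<sigma>\<close>-algebra \<open>path_borel S\<close> (proved
  below), so the image measures in \<open>invariant_measure\<close> are the genuine push-forwards.\<close>

definition path_borel :: "(real \<Rightarrow> 'a::topological_space) set \<Rightarrow> (real \<Rightarrow> 'a) measure" where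
  "path_borel S = borel_of (subtopology compact_open S)"

definition invariant_measure ::
  "(real \<Rightarrow> 'a::topological_space) set \<Rightarrow> 'a measure \<Rightarrow> bool" where
  "invariant_measure S \<mu> \<longleftrightarrow>
     prob_space \<mu> \<and> sets \<mu> = sets borel \<and>
     (\<exists>\<nu>. prob_space \<nu> \<and> sets \<nu> = sets (path_borel S) \<and>
          (\<forall>t. distr \<nu> \<nu> (path_shift t) = \<nu>) \<and>
          \<mu> = distr \<nu> borel eval0)"

definition V :: "(real \<Rightarrow> 'a) set \<Rightarrow> real \<Rightarrow> 'a set \<Rightarrow> 'a set" where
  "V S t E = {\<phi> t | \<phi>. \<phi> \<in> S \<and> \<phi> 0 \<in> E}"

definition V_inv :: "(real \<Rightarrow> 'a) set \<Rightarrow> real \<Rightarrow> 'a set \<Rightarrow> 'a set" where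
  "V_inv S t E = {x. V S t {x} \<inter> E \<noteq> {}}"

text \<open>\<open>V_inv S t E\<close> is the image under \<open>eval0\<close> of a Borel set of \<open>S\<close>. As \<open>S\<close> is an arbitrary
  shift-invariant set, \<open>recurrent_set S B\<close> need not be measurable, even for the completion
  of an invariant measure: let \<open>S\<close> consist of the constant paths in a subset of \<open>[0,1]\<close> with
  outer Lebesgue measure 1 and inner measure 0, let \<open>\<nu>\<close> be the trace of Lebesgue measure, and
  let \<open>B = [0,1]\<close>.\<close>

definition recurrent_set :: "(real \<Rightarrow> 'a) set \<Rightarrow> 'a set \<Rightarrow> 'a set" where
  "recurrent_set S B = (\<Inter>N::nat. \<Union>n\<in>{N..}. V_inv S (real n) B)"

lemma openin_compact_open:
  "compact K \<Longrightarrow> open U \<Longrightarrow> openin compact_open {\<phi>. continuous_on UNIV \<phi> \<and> \<phi> ` K \<subseteq> U}"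
  unfolding compact_open_def by (rule topology_generated_by_Basis) blast

lemma continuous_map_eval0: "continuous_map compact_open euclidean eval0"
proof (unfold continuous_map_def, intro conjI allI impI)
  fix U :: "'a set"
  assume "openin euclidean U"
  then have "openin compact_open {\<phi>. continuous_on UNIV \<phi> \<and> \<phi> ` {0} \<subseteq> U}"
    by (intro openin_compact_open) auto
  then show "openin compact_open {\<phi> \<in> topspace compact_open. eval0 \<phi> \<in> U}"
    by (simp add: topspace_compact_open eval0_def)
qed auto

lemma continuous_on_shift_iff:
  "continuous_on UNIV (path_shift t \<phi>) \<longleftrightarrow> continuous_on UNIV \<phi>"
proof
  assume "continuous_on UNIV (path_shift t \<phi>)"
  then have "continuous_on UNIV (\<lambda>s. path_shift t \<phi> (s - t))"
    by (rule continuous_on_compose2) (auto intro!: continuous_intros)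
  then show "continuous_on UNIV \<phi>"
    by (simp add: path_shift_def)
next
  assume "continuous_on UNIV \<phi>"
  then show "continuous_on UNIV (path_shift t \<phi>)"
    unfolding path_shift_def by (rule continuous_on_compose2) (auto intro!: continuous_intros)
qed

lemma continuous_map_shift:
  "continuous_map compact_open (compact_open :: (real \<Rightarrow> 'a::topological_space) topology) (path_shift t)"
proof -
  let ?W = "\<lambda>(K :: real set) U :: 'a set. {\<phi>. continuous_on UNIV \<phi> \<and> \<phi> ` K \<subseteq> U}"
  let ?\<W> = "{?W K U | K U. compact K \<and> open U}"
  have "continuous_map compact_open (topology_generated_by ?\<W>) (path_shift t)"
  proof (rule continuous_on_generated_topo)
    fix W
    assume "W \<in> ?\<W>"
    then obtain K U where W: "W = ?W K U" "compact K" "open U"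
      by blast
    have *: "path_shift t -` W \<inter> topspace compact_open = ?W ((\<lambda>s. s + t) ` K) U"
      unfolding W(1) vimage_def mem_Collect_eq continuous_on_shift_iff topspace_compact_open
      by (auto simp: path_shift_def)
    have "compact ((\<lambda>s. s + t) ` K)"
      using W(2) by (intro compact_continuous_image continuous_intros)
    then show "openin compact_open (path_shift t -` W \<inter> topspace compact_open)"
      unfolding * using W(3) by (rule openin_compact_open)
  next
    have "path_shift t \<phi> \<in> ?W {} UNIV" if "\<phi> \<in> topspace compact_open" for \<phi> :: "real \<Rightarrow> 'a"
      using that by (simp add: topspace_compact_open continuous_on_shift_iff)
    moreover have "?W {} UNIV \<in> ?\<W>"
      by blast
    ultimately show "path_shift t ` topspace compact_open \<subseteq> \<Union> ?\<W>"
      by blast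
  qed
  then show ?thesis
    unfolding compact_open_def[symmetric] .
qed

lemma measurable_borel_of:
  assumes "continuous_map T T' f"
  shows "f \<in> measurable (borel_of T) (borel_of T')"
  unfolding borel_of_def[of T']
proof (rule measurable_measure_of)
  show "{U. openin T' U} \<subseteq> Pow (topspace T')"
    by (auto dest: openin_subset)
  show "f \<in> space (borel_of T) \<rightarrow> topspace T'"
    using assms by (auto simp: continuous_map_def)
next
  fix U
  assume "U \<in> {U. openin T' U}"
  then have "openin T {x \<in> topspace T. f x \<in> U}"
    using assms by (auto simp: continuous_map_def)
  moreover have "f -` U \<inter> space (borel_of T) = {x \<in> topspace T. f x \<in> U}"
    by auto
  ultimately show "f -` U \<inter> space (borel_of T) \<in> sets (borel_of T)"
    by (auto simp: sets_borel_of)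
qed

lemma measurable_eval0: "eval0 \<in> measurable (path_borel S) borel"
proof -
  have "borel_of euclidean = (borel :: 'a measure)"
    by (simp add: borel_of_def borel_def flip: open_openin)
  moreover have "eval0 \<in> measurable (path_borel S) (borel_of euclidean)"
    unfolding path_borel_def
    by (intro measurable_borel_of continuous_map_from_subtopology continuous_map_eval0)
  ultimately show ?thesis
    by simp
qed

lemma measurable_shift:
  assumes "shift_invariant S"
  shows "path_shift t \<in> measurable (path_borel S) (path_borel S)"
  unfolding path_borel_def
  by (intro measurable_borel_of continuous_map_into_subtopology
      continuous_map_from_subtopology continuous_map_shift)
    (use assms in \<open>auto simp: shift_invariant_def\<close>)

end

theory Submission
  imports Defs
begin

text \<open>The statement is the Poincare recurrence theorem for the shift by one on path space, pushed
  down to \<open>X\<close> by evaluation at zero. A path that starts in \<open>E\<close> and lies in \<open>E \<subseteq> B\<close> at infinitely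
  many natural times witnesses that its starting point is recurrent to \<open>B\<close>. Hence if a Borel set
  \<open>E \<subseteq> B\<close> has only non-recurrent points, no path starting in \<open>E\<close> comes back to \<open>E\<close> infinitely often,
  and \<open>AE_infinitely_many_returns\<close> forces the set of paths starting in \<open>E\<close> to be \<open>\<nu>\<close>-null, that is
  \<open>\<mu> E = 0\<close>. So the non-recurrent part of \<open>B\<close> has inner measure zero
  (\<open>emeasure_nonrecurrent_eq_0\<close>).

  The other claims follow from this without further dynamics. A measurable cover of the recurrent
  part misses only a measurable set of non-recurrent points of \<open>B\<close>, so it has at least the measure of
  \<open>B\<close>; and a set of inner measure zero that is measurable for the completion is a null set there.\<close>

text \<open>The sets \<open>A\<^sub>N\<close> of points that visit \<open>A\<close> at some time \<open>\<ge> N\<close> satisfy \<open>A\<^sub>N\<^sub>+\<^sub>1 = T\<inverse> A\<^sub>N\<close>. They thus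
  decrease while all having the same finite measure, and so agree up to null sets with \<open>A\<^sub>0\<close>, which
  contains \<open>A\<close>.\<close>

lemma (in finite_measure) AE_infinitely_many_returns:
  assumes T: "T \<in> measurable M M"
    and invariant: "distr M M T = M"
    and A: "A \<in> sets M"
  shows "AE x in M. x \<in> A \<longrightarrow> infinite {n. (T ^^ n) x \<in> A}"
proof -
  define D where "D N = {x \<in> space M. \<exists>n\<ge>N. (T ^^ n) x \<in> A}" for N
  have Tn: "T ^^ n \<in> measurable M M" for n
    using T by (rule measurable_compose_n)
  have D: "D N \<in> sets M" for N
  proof -
    have "D N = (\<Union>n\<in>{N..}. (T ^^ n) -` A \<inter> space M)"
      by (auto simp: D_def)
    also have "\<dots> \<in> sets M"
      using measurable_sets[OF Tn A] by (intro sets.countable_UN') auto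
    finally show ?thesis .
  qed
  have preimage: "D (Suc N) = T -` D N \<inter> space M" for N
  proof -
    have "(\<exists>n\<ge>Suc N. P n) \<longleftrightarrow> (\<exists>n\<ge>N. P (Suc n))" for P :: "nat \<Rightarrow> bool"
      by (auto dest: Suc_le_D simp del: Suc_le_eq)
    then have "(\<exists>n\<ge>Suc N. (T ^^ n) x \<in> A) \<longleftrightarrow> (\<exists>n\<ge>N. (T ^^ n) (T x) \<in> A)" for x
      by (simp add: funpow_Suc_right del: funpow.simps)
    then show ?thesis
      using measurable_space[OF T] by (auto simp: D_def)
  qed
  have "emeasure M (D (Suc N)) = emeasure M (D N)" for N
    using emeasure_distr[OF T D, of N] by (simp only: preimage invariant)
  then have same: "emeasure M (D N) = emeasure M (D 0)" for N
    by (induction N) simp_all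
  have null: "D 0 - D N \<in> null_sets M" for N
  proof (rule null_setsI)
    have "D N \<subseteq> D 0"
      by (auto simp: D_def)
    then show "emeasure M (D 0 - D N) = 0"
      using D same[of N] by (simp add: emeasure_Diff)
  qed (use D in auto)
  have "AE x in M. \<forall>N. x \<notin> D 0 - D N"
    unfolding AE_all_countable using null AE_not_in by blast
  then show ?thesis
  proof (rule AE_mp, intro AE_I2 impI)
    fix x
    assume x: "x \<in> space M" "\<forall>N. x \<notin> D 0 - D N" "x \<in> A"
    then have "x \<in> D 0"
      by (auto simp: D_def intro: exI[of _ 0])
    then have "\<forall>N. x \<in> D N"
      using x by blast
    then show "infinite {n. (T ^^ n) x \<in> A}"
      by (auto simp: D_def infinite_nat_iff_unbounded_le)
  qed
qed

lemma funpow_path_shift: "(path_shift t ^^ n) \<phi> = path_shift (real n * t) \<phi>"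
  by (induction n) (simp_all add: path_shift_def algebra_simps)

lemma mem_recurrent_set_iff:
  "x \<in> recurrent_set S B \<longleftrightarrow> infinite {n::nat. x \<in> V_inv S (real n) B}"
  by (auto simp: recurrent_set_def infinite_nat_iff_unbounded_le)

text \<open>The paths that start in \<open>E\<close> form a measurable set, and none of them returns to it infinitely
  often, so Poincare recurrence makes this set null. The set of recurrent points itself is a
  projection from path space and need not be measurable; this is why the non-recurrent part of \<open>B\<close> is
  only probed by Borel subsets \<open>E\<close>.\<close>

lemma emeasure_nonrecurrent_eq_0:
  fixes S :: "(real \<Rightarrow> 'a::topological_space) set"
  assumes paths: "S \<subseteq> {\<phi>. continuous_on UNIV \<phi>}"
    and shift: "shift_invariant S"
    and inv: "invariant_measure S \<mu>"
    and E: "E \<in> sets borel" "E \<subseteq> B - recurrent_set S B"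
  shows "emeasure \<mu> E = 0"
proof -
  obtain \<nu> where \<nu>: "prob_space \<nu>" "sets \<nu> = sets (path_borel S)"
      "distr \<nu> \<nu> (path_shift 1) = \<nu>" "\<mu> = distr \<nu> borel eval0"
    using inv unfolding invariant_measure_def by blast
  interpret prob_space \<nu> by fact
  have space: "space \<nu> = S"
    using sets_eq_imp_space_eq[OF \<nu>(2)] paths
    by (auto simp: path_borel_def topspace_compact_open)
  have eval: "eval0 \<in> measurable \<nu> borel"
    using measurable_eval0[of S] by (simp add: measurable_cong_sets[OF \<nu>(2) refl])
  have T: "path_shift 1 \<in> measurable \<nu> \<nu>"
    using measurable_shift[OF shift] by (simp add: measurable_cong_sets[OF \<nu>(2) \<nu>(2)])
  define G where "G = eval0 -` E \<inter> space \<nu>"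
  have G: "G \<in> sets \<nu>"
    unfolding G_def using eval E(1) by (rule measurable_sets)
  have "finite {n. (path_shift 1 ^^ n) \<phi> \<in> G}" if "\<phi> \<in> G" for \<phi>
  proof -
    have "\<phi> \<in> S"
      using that space by (simp add: G_def)
    then have "\<phi> 0 \<in> V_inv S (real n) B" if "\<phi> (real n) \<in> B" for n
      using that by (auto simp: V_inv_def V_def)
    then have "{n. (path_shift 1 ^^ n) \<phi> \<in> G} \<subseteq> {n. \<phi> 0 \<in> V_inv S (real n) B}"
      using E(2) by (auto simp: G_def eval0_def funpow_path_shift path_shift_def)
    moreover have "finite {n. \<phi> 0 \<in> V_inv S (real n) B}"
      using that E(2) mem_recurrent_set_iff[of "\<phi> 0" S B] by (auto simp: G_def eval0_def)
    ultimately show ?thesis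
      by (rule finite_subset)
  qed
  then have "AE \<phi> in \<nu>. \<phi> \<notin> G"
    using AE_infinitely_many_returns[OF T \<nu>(3) G] by (simp cong: imp_cong)
  then have "emeasure \<nu> G = 0"
    using G AE_iff_null_sets by blast
  then show ?thesis
    using emeasure_distr[OF eval E(1)] by (simp add: \<nu>(4) G_def)
qed

text \<open>A set has full outer measure in \<open>B\<close> as soon as its complement in \<open>B\<close> has inner measure zero:
  the part of \<open>B\<close> missed by a measurable cover is a measurable subset of that complement.\<close>

lemma outer_measure_of_eq_if_inner_null:
  assumes B: "B \<in> sets M" and "C \<subseteq> B"
    and inner_null: "\<And>E. E \<in> sets M \<Longrightarrow> E \<subseteq> B - C \<Longrightarrow> emeasure M E = 0"
  shows "outer_measure_of M C = emeasure M B"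
proof (rule antisym)
  show "outer_measure_of M C \<le> emeasure M B"
    using outer_measure_of_mono[OF \<open>C \<subseteq> B\<close>, of M] B by simp
  show "emeasure M B \<le> outer_measure_of M C"
    unfolding outer_measure_of_def
  proof (rule INF_greatest)
    fix F
    assume "F \<in> {F \<in> sets M. C \<subseteq> F}"
    then have F: "F \<in> sets M" "C \<subseteq> F"
      by auto
    have "B - F \<in> null_sets M"
      using F B by (intro null_setsI inner_null) auto
    then have "emeasure M B = emeasure M (B - (B - F))"
      using B by (simp add: emeasure_Diff_null_set)
    also have "\<dots> \<le> emeasure M F"
      using F by (intro emeasure_mono) auto
    finally show "emeasure M B \<le> emeasure M F" .
  qed
qed

text \<open>The measure of a set in the completion is by definition that of a measurable subset, its main
  part.\<close>

lemma null_sets_completion_if_inner_null: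
  assumes N: "N \<in> sets (completion M)"
    and inner_null: "\<And>E. E \<in> sets M \<Longrightarrow> E \<subseteq> N \<Longrightarrow> emeasure M E = 0"
  shows "N \<in> null_sets (completion M)"
proof -
  have "main_part M N \<subseteq> N"
    using main_part_null_part_Un[OF N] by blast
  then have "emeasure M (main_part M N) = 0"
    using N by (intro inner_null main_part_sets)
  then show ?thesis
    using N by (intro null_setsI) simp_all
qed

theorem theorem6p5:
  fixes S :: "(real \<Rightarrow> 'a::metric_space) set"
    and \<mu> :: "'a measure"
    and B :: "'a set"
  assumes "separable_space (euclidean :: 'a topology)"
    and "S \<subseteq> {\<phi>. continuous_on UNIV \<phi>}"
    and "shift_invariant S"
    and "invariant_measure S \<mu>"
    and "B \<in> sets borel"
  shows "outer_measure_of \<mu> (B \<inter> recurrent_set S B) = emeasure \<mu> B \<and>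
    (\<forall>E\<in>sets \<mu>. E \<subseteq> {x \<in> B. \<not> infinite {n::nat. x \<in> V_inv S (real n) B}} \<longrightarrow> emeasure \<mu> E = 0) \<and>
    (B \<inter> recurrent_set S B \<in> sets (completion \<mu>) \<longrightarrow>
       emeasure (completion \<mu>) (B \<inter> recurrent_set S B) = emeasure \<mu> B \<and>
       (AE x in \<mu>. x \<in> B \<longrightarrow> infinite {n::nat. x \<in> V_inv S (real n) B}))"
proof (intro conjI impI)
  let ?R = "recurrent_set S B"
  have sets: "sets \<mu> = sets borel"
    using assms(4) by (simp add: invariant_measure_def)
  have B: "B \<in> sets \<mu>"
    using assms(5) sets by simp
  have nonrecurrent: "{x \<in> B. \<not> infinite {n::nat. x \<in> V_inv S (real n) B}} = B - B \<inter> ?R"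
    by (auto simp: mem_recurrent_set_iff)
  have inner_null: "emeasure \<mu> E = 0" if "E \<in> sets \<mu>" "E \<subseteq> B - B \<inter> ?R" for E
    using that sets by (intro emeasure_nonrecurrent_eq_0[OF assms(2-4), where B = B]) auto
  show "outer_measure_of \<mu> (B \<inter> ?R) = emeasure \<mu> B"
    using B inner_null by (intro outer_measure_of_eq_if_inner_null) auto
  show "\<forall>E\<in>sets \<mu>. E \<subseteq> {x \<in> B. \<not> infinite {n::nat. x \<in> V_inv S (real n) B}} \<longrightarrow> emeasure \<mu> E = 0"
    unfolding nonrecurrent using inner_null by blast
  assume R: "B \<inter> ?R \<in> sets (completion \<mu>)"
  have B': "B \<in> sets (completion \<mu>)"
    using B by simp
  have null: "B - B \<inter> ?R \<in> null_sets (completion \<mu>)"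
    using sets.Diff[OF B' R] inner_null by (rule null_sets_completion_if_inner_null)
  have "emeasure (completion \<mu>) (B - (B - B \<inter> ?R)) = emeasure (completion \<mu>) B"
    using null B' by (rule emeasure_Diff_null_set)
  moreover have "B - (B - B \<inter> ?R) = B \<inter> ?R"
    by blast
  ultimately show "emeasure (completion \<mu>) (B \<inter> ?R) = emeasure \<mu> B"
    using B by simp
  have "AE x in completion \<mu>. x \<notin> B - B \<inter> ?R"
    using null by (rule AE_not_in)
  then have "AE x in \<mu>. x \<notin> B - B \<inter> ?R"
    by (simp only: AE_completion_iff)
  then show "AE x in \<mu>. x \<in> B \<longrightarrow> infinite {n::nat. x \<in> V_inv S (real n) B}"
    by (rule AE_mp) (auto simp: mem_recurrent_set_iff)
qed

end
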